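(* Let $X$ be either the circle $\mathrm{S}^1=\mathbb{R}/\mathbb{Z}$ or the closed interval $[0,1]$. Let $\Gamma$ be a finitely generated group of orientation-preserving homeomorphisms of $X$, with sub-exponential growth, and let $\mathcal{G}$ be a finite generating set of $\Gamma$. Then for every $\varepsilon>0$ there exists a homeomorphism $\varphi: X\to X$ such that for every $g\in\mathcal{G}$, both $\varphi\circ g\circ\varphi^{-1}$ and $\varphi\circ g^{-1}\circ\varphi^{-1}$ are Lipschitz homeomorphisms of $X$ with Lipschitz constant $\le e^{\varepsilon}$.
   Context: A finitely generated group has sub-exponential growth if, for a (equivalently, any) finite generating set, the cardinality $|B(n)|$ of the ball of radius $n$ in the word metric satisfies $\lim_{n\to\infty}\frac1n\log|B(n)|=0$. A topological conjugate of $\Gamma$ is a group $\varphi\Gamma\varphi^{-1}$ with $\varphi$ a homeomorphism of $X$. $X$ carries its usual length metric. *)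

theory Defs
  imports "HOL-Analysis.Analysis" "HOL-Algebra.Bij" "HOL-Algebra.Generated_Groups"
begin

section \<open>The circle\<close>

quotient_type circle = real / "\<lambda>x y. x - y \<in> \<int>"
  morphisms rep_circle to_circle
proof (rule equivpI)
  show "reflp (\<lambda>x y::real. x - y \<in> \<int>)"
    by (simp add: reflp_def)
  show "symp (\<lambda>x y::real. x - y \<in> \<int>)"
  proof (rule sympI)
    fix x y :: real
    assume "x - y \<in> \<int>"
    then have "- (x - y) \<in> \<int>"
      by (rule Ints_minus)
    then show "y - x \<in> \<int>"
      by simp
  qed
  show "transp (\<lambda>x y::real. x - y \<in> \<int>)"
  proof (rule transpI)
    fix x y z :: real
    assume "x - y \<in> \<int>" "y - z \<in> \<int>"
    then have "(x - y) + (y - z) \<in> \<int>"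
      by (rule Ints_add)
    then show "x - z \<in> \<int>"
      by simp
  qed
qed

lemma circle_cases:
  obtains x where "u = to_circle x"
  using Quotient3_abs_rep[OF Quotient3_circle, of u] by metis

lemma to_circle_eq_iff: "to_circle x = to_circle y \<longleftrightarrow> x - y \<in> \<int>"
  by (rule circle.abs_eq_iff)

lemma round_add_of_int: "round (x + of_int k :: real) = round x + k"
proof -
  have "\<lfloor>x + of_int k + 1/2\<rfloor> = \<lfloor>(x + 1/2) + of_int k\<rfloor>"
    by (simp add: algebra_simps)
  then show ?thesis
    unfolding round_def by simp
qed

instantiation circle :: metric_space
begin

text \<open>The length of a shortest arc from \<^term>\<open>x\<close> to \<^term>\<open>y\<close> is the distance
  from the difference of representatives to the nearest integer; the circle has length 1.\<close>

lift_definition dist_circle :: "circle \<Rightarrow> circle \<Rightarrow> real"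
  is "\<lambda>x y. \<bar>(x - y) - of_int (round (x - y))\<bar>"
proof -
  fix x x' y y' :: real
  assume "x - x' \<in> \<int>" "y - y' \<in> \<int>"
  then obtain j k where "x - x' = of_int j" "y - y' = of_int k"
    by (auto elim!: Ints_cases)
  then have *: "x - y = (x' - y') + of_int (j - k)"
    by simp
  show "\<bar>x - y - of_int (round (x - y))\<bar> = \<bar>x' - y' - of_int (round (x' - y'))\<bar>"
    unfolding * round_add_of_int by simp
qed

definition uniformity_circle :: "(circle \<times> circle) filter" where
  "uniformity_circle = (INF e\<in>{0<..}. principal {(x, y). dist x y < e})"

definition open_circle :: "circle set \<Rightarrow> bool" where
  "open_circle U \<longleftrightarrow> (\<forall>x\<in>U. eventually (\<lambda>(x', y). x' = x \<longrightarrow> y \<in> U) uniformity)"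

instance
proof
  show "dist x y = 0 \<longleftrightarrow> x = y" for x y :: circle
  proof (transfer, standard)
    fix x y :: real
    assume "\<bar>x - y - of_int (round (x - y))\<bar> = 0"
    then have "x - y = of_int (round (x - y))"
      by linarith
    then obtain k where "x - y = of_int k"
      by blast
    then show "x - y \<in> \<int>"
      by simp
  next
    fix x y :: real
    assume "x - y \<in> \<int>"
    then show "\<bar>x - y - of_int (round (x - y))\<bar> = 0"
      by (auto elim!: Ints_cases)
  qed
  show "dist x y \<le> dist x z + dist y z" for x y z :: circle
  proof transfer
    fix x y z :: real
    have "\<bar>x - y - of_int (round (x - y))\<bar>
        \<le> \<bar>x - y - of_int (round (x - z) - round (y - z))\<bar>"
      by (rule round_diff_minimal)
    also have "\<dots> \<le> \<bar>x - z - of_int (round (x - z))\<bar> + \<bar>y - z - of_int (round (y - z))\<bar>"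
      by simp
    finally show "\<bar>x - y - of_int (round (x - y))\<bar>
        \<le> \<bar>x - z - of_int (round (x - z))\<bar> + \<bar>y - z - of_int (round (y - z))\<bar>" .
  qed
qed (simp_all add: uniformity_circle_def open_circle_def)

end

lemma dist_to_circle_le: "dist (to_circle x) (to_circle y) \<le> \<bar>x - y\<bar>"
  using round_diff_minimal[of "x - y" 0] by (simp add: dist_circle.abs_eq)

lemma continuous_on_to_circle: "continuous_on A to_circle"
  by (rule lipschitz_on_continuous_on[of 1])
     (simp add: lipschitz_on_def dist_to_circle_le dist_real_def)

text \<open>The metric topology is the quotient topology of the real line.\<close>

lemma open_circle_iff: "open U \<longleftrightarrow> open (to_circle -` U)"
proof
  show "open U \<Longrightarrow> open (to_circle -` U)"
    by (rule open_vimage[OF _ continuous_on_to_circle])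
next
  assume op: "open (to_circle -` U)"
  show "open U"
    unfolding open_dist
  proof
    fix u assume "u \<in> U"
    obtain x where x: "u = to_circle x"
      by (rule circle_cases)
    with \<open>u \<in> U\<close> op obtain e where e: "e > 0" "\<And>y. dist y x < e \<Longrightarrow> to_circle y \<in> U"
      unfolding open_dist by auto
    have "v \<in> U" if "dist v u < e" for v
    proof -
      obtain y where y: "v = to_circle y"
        by (rule circle_cases)
      let ?y = "y - of_int (round (y - x))"
      have "dist ?y x < e"
        using that by (simp add: x y dist_circle.abs_eq dist_real_def algebra_simps)
      moreover have "to_circle ?y = v"
        by (simp add: y to_circle_eq_iff)
      ultimately show ?thesis
        using e(2) by metis
    qed
    with \<open>e > 0\<close> show "\<exists>e>0. \<forall>v. dist v u < e \<longrightarrow> v \<in> U"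
      by blast
  qed
qed


section \<open>Orientation-preserving homeomorphisms\<close>

text \<open>A homeomorphism of the circle preserves the orientation if it lifts to an increasing
  homeomorphism of the real line commuting with integer translations.\<close>

definition homeo_plus_circle :: "(circle \<Rightarrow> circle) set" where
  "homeo_plus_circle =
     {f. (\<exists>g. homeomorphism UNIV UNIV f g) \<and>
         (\<exists>F. continuous_on UNIV F \<and> strict_mono F \<and> (\<forall>x::real. F (x + 1) = F x + 1) \<and>
              (\<forall>x. f (to_circle x) = to_circle (F x)))}"

text \<open>As in \<^const>\<open>Bij\<close>, maps on the interval are taken to be extensional, so that equality of
  maps is equality on the interval.\<close>

definition homeo_plus_interval :: "(real \<Rightarrow> real) set" where
  "homeo_plus_interval =
     {f \<in> extensional {0..1}.
         (\<exists>g. homeomorphism {0..1} {0..1} f g) \<and> strict_mono_on {0..1} f}"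


section \<open>Growth of groups\<close>

definition word_ball :: "('a, 'b) monoid_scheme \<Rightarrow> 'a set \<Rightarrow> nat \<Rightarrow> 'a set" where
  "word_ball G S n =
     {foldr (\<otimes>\<^bsub>G\<^esub>) ws \<one>\<^bsub>G\<^esub> | ws. set ws \<subseteq> S \<union> m_inv G ` S \<and> length ws \<le> n}"

definition subexponential_growth :: "('a, 'b) monoid_scheme \<Rightarrow> bool" where
  "subexponential_growth G \<longleftrightarrow>
     (\<exists>S. finite S \<and> S \<subseteq> carrier G \<and> generate G S = carrier G \<and>
          (\<lambda>n. 1 / real n * ln (real (card (word_ball G S n)))) \<longlonglongrightarrow> 0)"

end

theory Submission
  imports Defs
begin

text \<open>
  The idea is to average Lebesgue measure over the group. Let \<open>\<ell>\<close> be a word length on \<open>\<Gamma>\<close>. Under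
  subexponential growth the weights \<open>w g = exp (- \<delta> * \<ell> g)\<close> are summable for every \<open>\<delta> > 0\<close>; normalise
  them to have sum 1. The triangle inequality \<open>\<ell> (g h) \<le> \<ell> g + \<ell> h\<close> gives
  \<open>w g \<le> exp (\<delta> * \<ell> h) * w (g h)\<close>, and \<open>\<delta>\<close> can be chosen so small that the factor is at most
  \<open>exp \<epsilon>\<close> for the finitely many \<open>h\<close> that are generators or inverses of generators
  (\<open>subexponential_growth_weights\<close>).

  On the interval, let \<open>\<phi> x\<close> be the sum of \<open>w g * g x\<close> over \<open>g \<in> \<Gamma>\<close>: the distribution function of the
  weighted average of the pullbacks of Lebesgue measure by the elements of \<open>\<Gamma>\<close>. It is a
  homeomorphism, because a uniformly convergent sum of increasing homeomorphisms with positive weights is continuous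
  and strictly increasing. Precomposing with \<open>h\<close> replaces \<open>g\<close> by \<open>g h\<close> in the sum, so after reindexing it amounts
  to a change of the weights by a factor of at most \<open>exp \<epsilon>\<close> (\<open>average_translate_le\<close>):
  \<open>\<phi> (h y) - \<phi> (h x) \<le> exp \<epsilon> * (\<phi> y - \<phi> x)\<close> for \<open>x \<le> y\<close>. Substituting \<open>x = \<psi> u\<close> and \<open>y = \<psi> v\<close> with
  \<open>\<psi>\<close> the inverse of \<open>\<phi>\<close>, this says that \<open>\<phi> \<circ> h \<circ> \<psi>\<close> is Lipschitz with constant \<open>exp \<epsilon>\<close>.

  On the circle, the same average is taken over lifts to the real line, minus their values at 0. Two lifts
  of a homeomorphism differ by a constant (\<open>lifts_increment_unique\<close>), so the increments of the lift
  of a product agree with those of the product of the lifts, and the estimate above carries over. The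
  average commutes with the unit translation and descends to the circle. A bound for the lift of \<open>\<phi> \<circ> h \<circ> \<psi>\<close> passes to the circle because any two
  points have representatives at the distance of the points (\<open>lifts_lipschitz\<close>).
\<close>

section \<open>Word length and exponential weights\<close>

definition word_length :: "('a, 'b) monoid_scheme \<Rightarrow> 'a set \<Rightarrow> 'a \<Rightarrow> nat" where
  "word_length G S g = (LEAST n. g \<in> word_ball G S n)"

context group
begin

lemma foldr_mult_closed:
  assumes "set us \<subseteq> carrier G"
  shows "foldr (\<otimes>) us \<one> \<in> carrier G"
  using assms by (induction us) auto

lemma foldr_mult_append:
  assumes "set us \<subseteq> carrier G" "set vs \<subseteq> carrier G"
  shows "foldr (\<otimes>) (us @ vs) \<one> = foldr (\<otimes>) us \<one> \<otimes> foldr (\<otimes>) vs \<one>"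
  using assms by (induction us) (auto simp: foldr_mult_closed m_assoc simp del: foldr_append)

lemma word_ball_mult:
  assumes "S \<subseteq> carrier G" "g \<in> word_ball G S m" "h \<in> word_ball G S n"
  shows "g \<otimes> h \<in> word_ball G S (m + n)"
proof -
  have S: "S \<union> m_inv G ` S \<subseteq> carrier G"
    using assms(1) by auto
  obtain us where us: "g = foldr (\<otimes>) us \<one>" "set us \<subseteq> S \<union> m_inv G ` S" "length us \<le> m"
    using assms(2) unfolding word_ball_def by blast
  obtain vs where vs: "h = foldr (\<otimes>) vs \<one>" "set vs \<subseteq> S \<union> m_inv G ` S" "length vs \<le> n"
    using assms(3) unfolding word_ball_def by blast
  have "g \<otimes> h = foldr (\<otimes>) (us @ vs) \<one>"
    using foldr_mult_append[of us vs] us vs S by (metis subset_trans)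
  moreover have "set (us @ vs) \<subseteq> S \<union> m_inv G ` S" "length (us @ vs) \<le> m + n"
    using us vs by auto
  ultimately show ?thesis
    unfolding word_ball_def by blast
qed

lemma generate_imp_word_ball:
  assumes "S \<subseteq> carrier G" "g \<in> generate G S"
  shows "\<exists>n. g \<in> word_ball G S n"
  using assms(2)
proof induction
  case one
  have "foldr (\<otimes>) [] \<one> \<in> word_ball G S 0"
    unfolding word_ball_def by fastforce
  then show ?case by auto
next
  case (incl h)
  have "foldr (\<otimes>) [h] \<one> \<in> word_ball G S 1"
    unfolding word_ball_def using incl by fastforce
  moreover have "h \<otimes> \<one> = h"
    using incl assms(1) by auto
  ultimately show ?case by auto
next
  case (inv h)
  have "foldr (\<otimes>) [inv h] \<one> \<in> word_ball G S 1"
    unfolding word_ball_def using inv by fastforce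
  moreover have "inv h \<otimes> \<one> = inv h"
    using inv assms(1) by auto
  ultimately show ?case by auto
next
  case (eng h1 h2)
  then show ?case using word_ball_mult[OF assms(1)] by blast
qed

lemma word_length_mult_le:
  assumes "S \<subseteq> carrier G" "g \<in> generate G S" "h \<in> generate G S"
  shows "word_length G S (g \<otimes> h) \<le> word_length G S g + word_length G S h"
proof -
  have "g \<in> word_ball G S (word_length G S g)" "h \<in> word_ball G S (word_length G S h)"
    using generate_imp_word_ball[OF assms(1)] assms(2,3)
    unfolding word_length_def by (meson LeastI_ex)+
  from word_ball_mult[OF assms(1) this] show ?thesis
    unfolding word_length_def[of G S "g \<otimes> h"] by (rule Least_le)
qed

end

lemma finite_word_ball:
  assumes "finite S"
  shows "finite (word_ball G S n)"
proof -
  have "finite {ws. set ws \<subseteq> S \<union> m_inv G ` S \<and> length ws \<le> n}"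
    using assms by (intro finite_lists_length_le) auto
  from finite_imageI[OF this, of "\<lambda>ws. foldr (\<otimes>\<^bsub>G\<^esub>) ws \<one>\<^bsub>G\<^esub>"] show ?thesis
    unfolding word_ball_def by (rule rev_finite_subset) auto
qed

text \<open>Eventually the ball of radius \<open>n\<close> has at most \<open>exp (n * \<delta> / 2)\<close> elements, which leaves
  half of the decay: the series is dominated by the geometric series of ratio \<open>exp (- \<delta> / 2)\<close>.\<close>

lemma summable_word_ball_growth:
  assumes "(\<lambda>n. 1 / real n * ln (real (card (word_ball G S n)))) \<longlonglongrightarrow> 0"
    and "finite S" "\<delta> > 0"
  shows "summable (\<lambda>n. real (card (word_ball G S n)) * exp (- \<delta>) ^ n)"
proof (rule summable_comparison_test_ev)
  show "summable (\<lambda>n. exp (- \<delta> / 2) ^ n)"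
    using \<open>\<delta> > 0\<close> by (intro summable_geometric) auto
  have "eventually (\<lambda>n. 1 / real n * ln (real (card (word_ball G S n))) < \<delta> / 2) sequentially"
    using order_tendstoD(2)[OF assms(1), of "\<delta> / 2"] \<open>\<delta> > 0\<close> by simp
  then show "\<forall>\<^sub>F n in sequentially.
      norm (real (card (word_ball G S n)) * exp (- \<delta>) ^ n) \<le> exp (- \<delta> / 2) ^ n"
    using eventually_gt_at_top[of "0::nat"]
  proof eventually_elim
    case (elim n)
    have "foldr (\<otimes>\<^bsub>G\<^esub>) [] \<one>\<^bsub>G\<^esub> \<in> word_ball G S n"
      unfolding word_ball_def by fastforce
    then have "card (word_ball G S n) > 0"
      using finite_word_ball[OF assms(2)] by (metis card_gt_0_iff empty_iff)
    moreover have "ln (real (card (word_ball G S n))) \<le> real n * (\<delta> / 2)"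
      using elim by (simp add: field_simps)
    ultimately have "real (card (word_ball G S n)) \<le> exp (real n * (\<delta> / 2))"
      by (metis exp_le_cancel_iff exp_ln of_nat_0_less_iff)
    then have "real (card (word_ball G S n)) * exp (- \<delta>) ^ n
        \<le> exp (real n * (\<delta> / 2)) * exp (- \<delta>) ^ n"
      by (intro mult_right_mono) auto
    also have "\<dots> = exp (- \<delta> / 2) ^ n"
      by (simp add: exp_of_nat_mult[symmetric] exp_add[symmetric] field_simps)
    finally show ?case by simp
  qed
qed

text \<open>The elements of length \<open>n\<close> lie in the ball of radius \<open>n\<close>, so grouping a finite partial sum
  by length bounds it by the growth series.\<close>

lemma (in group) word_length_weight_summable:
  fixes \<delta> :: real
  assumes "S \<subseteq> carrier G" "generate G S = carrier G" "finite S" "\<delta> > 0"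
    and growth: "(\<lambda>n. 1 / real n * ln (real (card (word_ball G S n)))) \<longlonglongrightarrow> 0"
  shows "(\<lambda>g. exp (- \<delta>) ^ word_length G S g) summable_on carrier G"
proof (rule nonneg_bdd_above_summable_on)
  let ?l = "word_length G S" and ?B = "word_ball G S"
  let ?s = "\<lambda>n. real (card (?B n)) * exp (- \<delta>) ^ n"
  have "(\<Sum>g\<in>A. exp (- \<delta>) ^ ?l g) \<le> suminf ?s" if A: "A \<subseteq> carrier G" "finite A" for A
  proof -
    have "(\<Sum>g\<in>A. exp (- \<delta>) ^ ?l g)
        = (\<Sum>n\<in>?l ` A. \<Sum>g\<in>{g \<in> A. ?l g = n}. exp (- \<delta>) ^ ?l g)"
      by (rule sum.image_gen[OF A(2)])
    also have "\<dots> \<le> (\<Sum>n\<in>?l ` A. ?s n)"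
    proof (rule sum_mono)
      fix n
      have "{g \<in> A. ?l g = n} \<subseteq> ?B n"
      proof
        fix g assume g: "g \<in> {g \<in> A. ?l g = n}"
        then have "\<exists>m. g \<in> ?B m"
          using generate_imp_word_ball[OF assms(1)] assms(2) A(1) by blast
        then show "g \<in> ?B n"
          using g unfolding word_length_def by (metis (mono_tags, lifting) LeastI_ex mem_Collect_eq)
      qed
      then have "card {g \<in> A. ?l g = n} \<le> card (?B n)"
        by (intro card_mono finite_word_ball assms)
      then show "(\<Sum>g\<in>{g \<in> A. ?l g = n}. exp (- \<delta>) ^ ?l g) \<le> ?s n"
        by (simp add: mult_right_mono)
    qed
    also have "\<dots> \<le> suminf ?s"
      using A summable_word_ball_growth[OF growth assms(3,4)] by (intro sum_le_suminf) auto
    finally show ?thesis .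
  qed
  then show "bdd_above (sum (\<lambda>g. exp (- \<delta>) ^ ?l g) ` {F. F \<subseteq> carrier G \<and> finite F})"
    by (intro bdd_aboveI2[where M = "suminf ?s"]) auto
qed simp

text \<open>The weight \<open>exp (- \<delta> * length)\<close> changes by a factor of at most \<open>exp (\<delta> * length of h)\<close> under right
  multiplication by \<open>h\<close>. Lengths are taken with respect to a generating set \<open>S\<close> that witnesses
  subexponential growth. Dealing with an arbitrary \<open>T\<close> takes no comparison of word metrics: one keeps
  the metric of \<open>S\<close> and divides the rate \<open>\<epsilon>\<close> by a bound \<open>k\<close> on the \<open>S\<close>-lengths of the elements
  of \<open>T\<close>.\<close>

lemma (in group) subexponential_growth_weights:
  assumes "subexponential_growth G" "finite T" "T \<subseteq> carrier G" "\<epsilon> > 0"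
  obtains w :: "'a \<Rightarrow> real" where
    "\<And>g. g \<in> carrier G \<Longrightarrow> w g > 0"
    "(w has_sum 1) (carrier G)"
    "\<And>g h. \<lbrakk>g \<in> carrier G; h \<in> T\<rbrakk> \<Longrightarrow> w g \<le> exp \<epsilon> * w (g \<otimes> h)"
proof -
  obtain S where S: "finite S" "S \<subseteq> carrier G" "generate G S = carrier G"
    and growth: "(\<lambda>n. 1 / real n * ln (real (card (word_ball G S n)))) \<longlonglongrightarrow> 0"
    using assms(1) unfolding subexponential_growth_def by blast
  let ?l = "word_length G S"
  define k where "k = Suc (\<Sum>h\<in>T. ?l h)"
  define \<delta> where "\<delta> = \<epsilon> / real k"
  define u where "u g = exp (- \<delta>) ^ ?l g" for g
  define c where "c = infsum u (carrier G)"
  have "\<delta> > 0"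
    using assms(4) by (simp only: \<delta>_def k_def divide_pos_pos of_nat_0_less_iff zero_less_Suc)
  have k\<delta>: "real k * \<delta> = \<epsilon>"
    unfolding \<delta>_def using k_def by (simp del: of_nat_Suc)
  have u_pos: "u g > 0" for g
    by (simp add: u_def)
  have "u summable_on carrier G"
    unfolding u_def using S growth \<open>\<delta> > 0\<close> by (intro word_length_weight_summable)
  then have c_sum: "(u has_sum c) (carrier G)"
    unfolding c_def by (rule has_sum_infsum)
  have "((\<lambda>_. 0) has_sum 0) (carrier G)"
    by (rule has_sum_0) simp
  then have "0 < c"
    using has_sum_strict_mono[OF _ c_sum, of "\<lambda>_. 0" 0 \<one>] u_pos by (simp add: less_imp_le)
  show ?thesis
  proof (rule that[of "\<lambda>g. u g / c"])
    show "u g / c > 0" for g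
      using u_pos \<open>0 < c\<close> by simp
    show "((\<lambda>g. u g / c) has_sum 1) (carrier G)"
      using has_sum_cmult_left[OF c_sum, of "1 / c"] \<open>0 < c\<close> by simp
    fix g h assume g: "g \<in> carrier G" and h: "h \<in> T"
    have "?l h \<le> k"
      using member_le_sum[OF h, of ?l] assms(2) by (simp add: k_def)
    moreover have "?l (g \<otimes> h) \<le> ?l g + ?l h"
      using word_length_mult_le[OF S(2), of g h] S(3) g h assms(3) by auto
    ultimately have "?l (g \<otimes> h) \<le> ?l g + k"
      by simp
    then have "exp (- \<delta>) ^ (?l g + k) \<le> u (g \<otimes> h)"
      unfolding u_def using \<open>\<delta> > 0\<close> by (intro power_decreasing) auto
    then have "exp \<epsilon> * (u g * exp (- \<delta>) ^ k) \<le> exp \<epsilon> * u (g \<otimes> h)"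
      by (simp add: u_def power_add)
    moreover have "exp (- \<delta>) ^ k = exp (- \<epsilon>)"
      using k\<delta> by (simp add: exp_of_nat_mult[symmetric])
    ultimately have "u g \<le> exp \<epsilon> * u (g \<otimes> h)"
      by (simp add: exp_minus field_simps)
    then show "u g / c \<le> exp \<epsilon> * (u (g \<otimes> h) / c)"
      using \<open>0 < c\<close> by (simp add: field_simps)
  qed
qed

section \<open>Averages over a group\<close>

text \<open>The setting common to both spaces. For the interval, \<open>F g\<close> is \<open>g\<close> itself and \<open>K\<close> is \<open>[0,1]\<close>; for the
  circle, \<open>F g\<close> is a lift of \<open>g\<close> to \<open>K = \<real>\<close> minus its value at \<open>0\<close>. The bound \<open>\<bar>x\<bar> + 1\<close> is what such a
  function satisfies; being uniform in \<open>g\<close>, it makes the averages converge locally uniformly.\<close>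

locale averaged_maps = group G for G (structure) +
  fixes w :: "'a \<Rightarrow> real" and F :: "'a \<Rightarrow> real \<Rightarrow> real" and K :: "real set"
  assumes weight_pos: "g \<in> carrier G \<Longrightarrow> w g > 0"
    and weight_sum: "(w has_sum 1) (carrier G)"
    and maps_strict_mono: "g \<in> carrier G \<Longrightarrow> strict_mono_on K (F g)"
    and maps_continuous: "g \<in> carrier G \<Longrightarrow> continuous_on K (F g)"
    and maps_bound: "\<lbrakk>g \<in> carrier G; x \<in> K\<rbrakk> \<Longrightarrow> \<bar>F g x\<bar> \<le> \<bar>x\<bar> + 1"
begin

definition average :: "real \<Rightarrow> real" where
  "average x = (\<Sum>\<^sub>\<infinity>g\<in>carrier G. w g * F g x)"

lemma weighted_bound:
  assumes "g \<in> carrier G" "x \<in> K" "\<bar>x\<bar> \<le> r"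
  shows "norm (w g * F g x) \<le> w g * (r + 1)"
  using weight_pos[OF assms(1)] maps_bound[OF assms(1,2)] assms(3)
  by (auto simp: abs_mult intro!: mult_left_mono)

lemma weights_summable: "(\<lambda>g. w g * c) summable_on carrier G"
  using weight_sum by (intro summable_on_cmult_left) (auto simp: summable_on_def)

lemma average_has_sum:
  assumes "x \<in> K"
  shows "((\<lambda>g. w g * F g x) has_sum average x) (carrier G)"
  unfolding average_def
proof (rule has_sum_infsum, rule abs_summable_summable, rule Infinite_Sum.abs_summable_on_comparison_test')
  show "(\<lambda>g. w g * (\<bar>x\<bar> + 1)) summable_on carrier G"
    by (rule weights_summable)
qed (use weighted_bound assms in auto)

lemma average_strict_mono: "strict_mono_on K average"
proof (rule strict_mono_onI)
  fix x y assume "x \<in> K" "y \<in> K" "x < y"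
  then have "w g * F g x < w g * F g y" if "g \<in> carrier G" for g
    using that weight_pos strict_mono_onD[OF maps_strict_mono] by simp
  then show "average x < average y"
    using has_sum_strict_mono[OF average_has_sum[OF \<open>x \<in> K\<close>] average_has_sum[OF \<open>y \<in> K\<close>], of \<one>]
    by (simp add: less_imp_le)
qed

text \<open>On bounded sets the Weierstrass test applies; the real line is covered by these.\<close>

lemma average_continuous: "continuous_on K average"
proof -
  have bounded: "continuous_on (K \<inter> {-r<..<r}) average" for r
  proof (rule uniform_limit_theorem)
    show "uniform_limit (K \<inter> {-r<..<r}) (\<lambda>A x. \<Sum>g\<in>A. w g * F g x) average
        (finite_subsets_at_top (carrier G))"
      unfolding average_def
      by (rule Weierstrass_m_test_general[OF _ weights_summable[of "r + 1"]])
         (auto simp del: real_norm_def intro!: weighted_bound)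
    show "\<forall>\<^sub>F A in finite_subsets_at_top (carrier G).
        continuous_on (K \<inter> {-r<..<r}) (\<lambda>x. \<Sum>g\<in>A. w g * F g x)"
      by (rule eventually_finite_subsets_at_top_weakI)
         (auto intro!: continuous_intros continuous_on_subset[OF maps_continuous])
  qed simp
  have "continuous (at x within K) average" if "x \<in> K" for x
  proof -
    let ?r = "\<bar>x\<bar> + 1"
    have "-?r < x" "x < ?r"
      by linarith+
    then have "x \<in> K \<inter> {-?r<..<?r}"
      using that by simp
    have "continuous (at x within K \<inter> {-?r<..<?r}) average"
      using bounded[of ?r] \<open>x \<in> K \<inter> {-?r<..<?r}\<close>
      unfolding continuous_on_eq_continuous_within by blast
    moreover have "at x within K \<inter> {-?r<..<?r} = at x within K"
      using \<open>-?r < x\<close> \<open>x < ?r\<close> by (intro at_within_nhd[where S = "{-?r<..<?r}"]) auto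
    ultimately show ?thesis
      by simp
  qed
  then show ?thesis
    by (simp add: continuous_on_eq_continuous_within)
qed

text \<open>The heart of the proof. The increment of \<open>average \<circ> H\<close> is the sum of \<open>w g\<close> times the
  increments of \<open>F (g \<otimes> h)\<close>. Since right translation by \<open>h\<close> permutes the group, the increment of
  \<open>average\<close> is the sum of \<open>w (g \<otimes> h)\<close> times the same nonnegative increments, so that the two
  differ by the change of weights alone. The map \<open>H\<close> is \<open>h\<close> or its lift; only increments are
  compared because the lift of a product is the product of the lifts up to a constant.\<close>

lemma average_translate_le:
  assumes "h \<in> carrier G" "H ` K \<subseteq> K"
    and translate: "\<And>g x y. \<lbrakk>g \<in> carrier G; x \<in> K; y \<in> K\<rbrakk>
      \<Longrightarrow> F g (H y) - F g (H x) = F (g \<otimes> h) y - F (g \<otimes> h) x"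
    and quasi_invariant: "\<And>g. g \<in> carrier G \<Longrightarrow> w g \<le> C * w (g \<otimes> h)"
    and xy: "x \<in> K" "y \<in> K" "x \<le> y"
  shows "average (H y) - average (H x) \<le> C * (average y - average x)"
proof (rule has_sum_mono)
  have diff: "((\<lambda>g. w g * (F g v - F g u)) has_sum (average v - average u)) (carrier G)"
    if "u \<in> K" "v \<in> K" for u v
    using has_sum_add[OF average_has_sum[OF that(2)]
      has_sum_uminusI[OF average_has_sum[OF that(1)]]]
    by (simp add: algebra_simps)
  show "((\<lambda>g. w g * (F g (H y) - F g (H x))) has_sum (average (H y) - average (H x))) (carrier G)"
    using assms(2) xy by (intro diff) auto
  have "bij_betw (\<lambda>g. g \<otimes> h) (carrier G) (carrier G)"
    using assms(1)
    by (intro bij_betw_byWitness[where f' = "\<lambda>g. g \<otimes> inv h"]) (auto simp: m_assoc)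
  from has_sum_cmult_right[OF diff[OF xy(1,2)], of C]
  show "((\<lambda>g. C * (w (g \<otimes> h) * (F (g \<otimes> h) y - F (g \<otimes> h) x)))
      has_sum (C * (average y - average x))) (carrier G)"
    by (subst has_sum_reindex_bij_betw[OF \<open>bij_betw _ _ _\<close>])
  fix g assume g: "g \<in> carrier G"
  have "F (g \<otimes> h) x \<le> F (g \<otimes> h) y"
    using maps_strict_mono[of "g \<otimes> h"] g assms(1) xy
    by (simp add: strict_mono_on_leD)
  then show "w g * (F g (H y) - F g (H x)) \<le> C * (w (g \<otimes> h) * (F (g \<otimes> h) y - F (g \<otimes> h) x))"
    using mult_right_mono[OF quasi_invariant[OF g], of "F (g \<otimes> h) y - F (g \<otimes> h) x"]
    by (simp add: translate[OF g xy(1,2)] mult.assoc)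
qed

end

section \<open>Lifts of circle homeomorphisms\<close>

definition lifts :: "(real \<Rightarrow> real) \<Rightarrow> (circle \<Rightarrow> circle) \<Rightarrow> bool" where
  "lifts F f \<longleftrightarrow> continuous_on UNIV F \<and> strict_mono F \<and> (\<forall>x. F (x + 1) = F x + 1) \<and>
     (\<forall>x. f (to_circle x) = to_circle (F x))"

lemma liftsD:
  assumes "lifts F f"
  shows "continuous_on UNIV F" "strict_mono F" "F (x + 1) = F x + 1"
    "f (to_circle x) = to_circle (F x)"
  using assms by (auto simp: lifts_def)

lemma shift_by_int:
  fixes F :: "real \<Rightarrow> real"
  assumes "\<And>x. F (x + 1) = F x + 1"
  shows "F (x + of_int k) = F x + of_int k"
proof -
  have nat: "F (y + real n) = F y + real n" for y n
  proof (induction n)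
    case (Suc n)
    then show ?case
      using assms[of "y + real n"] by (simp add: algebra_simps)
  qed simp
  show ?thesis
  proof (cases "k \<ge> 0")
    case True
    then show ?thesis
      using nat[of x "nat k"] by simp
  next
    case False
    then show ?thesis
      using nat[of "x + of_int k" "nat (- k)"] by simp
  qed
qed

lemma lifts_compose:
  assumes "lifts F f" "lifts H h"
  shows "lifts (F \<circ> H) (f \<circ> h)"
  using assms unfolding lifts_def
  by (auto simp: strict_mono_def intro: continuous_on_compose2)

text \<open>The difference of two lifts of the same map is continuous and integer valued,
  hence constant.\<close>

lemma lifts_increment_unique:
  assumes "lifts F f" "lifts F' f"
  shows "F y - F x = F' y - F' x"
proof -
  have int: "F z - F' z \<in> \<int>" for z
    using liftsD(4)[OF assms(1), of z] liftsD(4)[OF assms(2), of z]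
    by (metis to_circle_eq_iff)
  have "(\<lambda>z. F z - F' z) constant_on UNIV"
  proof (rule continuous_discrete_range_constant)
    show "continuous_on UNIV (\<lambda>z. F z - F' z)"
      using liftsD(1)[OF assms(1)] liftsD(1)[OF assms(2)] by (intro continuous_intros)
    have "1 \<le> norm ((F z - F' z) - (F x - F' x))" if "F z - F' z \<noteq> F x - F' x" for x z
    proof -
      have "(F z - F' z) - (F x - F' x) \<in> \<int>"
        by (rule Ints_diff[OF int int])
      then show ?thesis
        using Ints_nonzero_abs_ge1[of "(F z - F' z) - (F x - F' x)"] that by simp
    qed
    then show "\<exists>e>0. \<forall>z. z \<in> UNIV \<and> F z - F' z \<noteq> F x - F' x
        \<longrightarrow> e \<le> norm ((F z - F' z) - (F x - F' x))" for x
      by (intro exI[of _ 1]) auto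
  qed simp
  then have "F y - F' y = F x - F' x"
    unfolding constant_on_def by (metis UNIV_I)
  then show ?thesis
    by simp
qed

text \<open>By monotonicity, \<open>F x\<close> lies between the values of \<open>F\<close> at the integers adjacent to \<open>x\<close>, which
  are \<open>F 0\<close> plus these integers.\<close>

lemma lifts_displacement_bound:
  assumes "lifts F f"
  shows "\<bar>F x - F 0\<bar> \<le> \<bar>x\<bar> + 1"
proof -
  note shift = shift_by_int[of F, OF liftsD(3)[OF assms]]
  have "F (of_int \<lfloor>x\<rfloor>) \<le> F x" "F x \<le> F (of_int (\<lfloor>x\<rfloor> + 1))"
    by (rule strict_mono_leD[OF liftsD(2)[OF assms]], linarith)+
  then have "F 0 + of_int \<lfloor>x\<rfloor> \<le> F x" "F x \<le> F 0 + of_int (\<lfloor>x\<rfloor> + 1)"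
    using shift[of 0 "\<lfloor>x\<rfloor>"] shift[of 0 "\<lfloor>x\<rfloor> + 1"] by auto
  then show ?thesis
    by linarith
qed

lemma lifts_continuous_on:
  assumes "lifts F f"
  shows "continuous_on UNIV f"
  unfolding continuous_on_open_vimage[OF open_UNIV]
proof (intro allI impI)
  fix U :: "circle set" assume "open U"
  have "to_circle -` (f -` U) = F -` (to_circle -` U)"
    using liftsD(4)[OF assms] by auto
  moreover have "open (F -` (to_circle -` U))"
    using \<open>open U\<close> liftsD(1)[OF assms] by (metis open_circle_iff open_vimage)
  ultimately show "open (f -` U \<inter> UNIV)"
    by (simp add: open_circle_iff)
qed

lemma lifts_lipschitz:
  assumes "lifts F f" "L \<ge> 0"
    and le: "\<And>x y. x \<le> y \<Longrightarrow> F y - F x \<le> L * (y - x)"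
  shows "L-lipschitz_on UNIV f"
proof (rule lipschitz_onI)
  fix u v :: circle
  obtain x where x: "u = to_circle x" by (rule circle_cases)
  obtain y0 where y0: "v = to_circle y0" by (rule circle_cases)
  \<comment> \<open>the representative of \<open>v\<close> nearest to \<open>x\<close> realises the distance\<close>
  define y where "y = y0 + of_int (round (x - y0))"
  have y: "v = to_circle y"
    by (simp add: y0 y_def to_circle_eq_iff)
  have dist_uv: "dist u v = \<bar>x - y\<bar>"
    unfolding x y0 dist_circle.abs_eq y_def by (simp add: algebra_simps)
  have "dist (f u) (f v) \<le> \<bar>F x - F y\<bar>"
    unfolding x y liftsD(4)[OF assms(1)] by (rule dist_to_circle_le)
  also have "\<dots> \<le> L * \<bar>x - y\<bar>"
  proof (cases "x \<le> y")
    case True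
    then show ?thesis
      using le[OF True] strict_mono_leD[OF liftsD(2)[OF assms(1)] True] by simp
  next
    case False
    then have "y \<le> x" by simp
    then show ?thesis
      using le[OF \<open>y \<le> x\<close>] strict_mono_leD[OF liftsD(2)[OF assms(1)] \<open>y \<le> x\<close>] by simp
  qed
  finally show "dist (f u) (f v) \<le> L * dist u v"
    by (simp add: dist_uv)
qed (rule assms(2))

text \<open>The map induced on the quotient; it does not depend on the choice made by \<^const>\<open>rep_circle\<close>
  as soon as \<open>F\<close> commutes with integer translations.\<close>

definition descend :: "(real \<Rightarrow> real) \<Rightarrow> circle \<Rightarrow> circle" where
  "descend F u = to_circle (F (rep_circle u))"

lemma lifts_descend:
  assumes "continuous_on UNIV F" "strict_mono F" "\<And>x. F (x + 1) = F x + 1"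
  shows "lifts F (descend F)"
proof -
  have "descend F (to_circle x) = to_circle (F x)" for x
  proof -
    have "to_circle (rep_circle (to_circle x)) = to_circle x"
      by (rule Quotient3_abs_rep[OF Quotient3_circle])
    then obtain k where "rep_circle (to_circle x) = x + of_int k"
      by (metis to_circle_eq_iff Ints_cases add.commute diff_add_cancel)
    then show ?thesis
      using shift_by_int[of F x k] assms(3) by (simp add: descend_def to_circle_eq_iff)
  qed
  then show ?thesis
    using assms by (simp add: lifts_def)
qed

text \<open>Surjectivity is the intermediate value theorem between integers; the inverse is monotone with
  open range, hence continuous.\<close>

lemma degree_one_lift_homeomorphism:
  fixes F :: "real \<Rightarrow> real"
  assumes "continuous_on UNIV F" "strict_mono F" "\<And>x. F (x + 1) = F x + 1"
  shows "homeomorphism UNIV UNIV F (inv_into UNIV F)"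
    and "strict_mono (inv_into UNIV F)"
    and "inv_into UNIV F (x + 1) = inv_into UNIV F x + 1"
proof -
  have "inj F"
    using assms(2) by (rule strict_mono_imp_inj_on)
  have "surj F"
  proof (rule surjI)
    fix y
    let ?n = "\<lfloor>y - F 0\<rfloor>"
    have "F (of_int ?n) = F 0 + of_int ?n" "F (of_int (?n + 1)) = F 0 + of_int (?n + 1)"
      using shift_by_int[of F 0, OF assms(3)] by (metis add_0)+
    then have "F (of_int ?n) \<le> y" "y \<le> F (of_int (?n + 1))"
      by linarith+
    then have "\<exists>x. of_int ?n \<le> x \<and> x \<le> of_int (?n + 1) \<and> F x = y"
      by (intro IVT') (auto intro: continuous_on_subset[OF assms(1)])
    then show "F (SOME x. F x = y) = y"
      by (metis (mono_tags, lifting) someI_ex)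
  qed
  show mono: "strict_mono (inv_into UNIV F)"
    using strict_mono_inv_on_range[OF assms(2)] \<open>surj F\<close> by simp
  show "homeomorphism UNIV UNIV F (inv_into UNIV F)"
  proof (rule homeomorphismI)
    show "continuous_on UNIV (inv_into UNIV F)"
      using \<open>inj F\<close> strict_mono_leD[OF mono]
      by (intro continuous_onI_mono) (auto simp: inj_imp_surj_inv)
  qed (use assms \<open>inj F\<close> \<open>surj F\<close> in \<open>auto simp: surj_f_inv_f\<close>)
  show "inv_into UNIV F (x + 1) = inv_into UNIV F x + 1"
    using assms(3)[of "inv_into UNIV F x"] \<open>inj F\<close> \<open>surj F\<close> by (metis inv_f_f surj_f_inv_f)
qed

lemma lifts_homeomorphism:
  assumes "lifts F f" "lifts F' f'" "\<And>x. F' (F x) = x" "\<And>x. F (F' x) = x"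
  shows "homeomorphism UNIV UNIV f f'"
proof (rule homeomorphismI)
  show "f' (f u) = u" "f (f' u) = u" for u
    using assms(3,4) liftsD(4)[OF assms(1)] liftsD(4)[OF assms(2)]
    by (cases u rule: circle_cases; simp)+
  show "continuous_on UNIV f" "continuous_on UNIV f'"
    by (fact lifts_continuous_on[OF assms(1)] lifts_continuous_on[OF assms(2)])+
qed auto

section \<open>Lipschitz conjugacies\<close>

lemma homeomorphism_inv_into:
  assumes "homeomorphism S T f g"
  shows "homeomorphism S T f (inv_into S f)"
proof (rule homeomorphism_cong[OF assms])
  fix y assume "y \<in> T"
  then obtain x where "x \<in> S" "y = f x"
    using homeomorphism_image1[OF assms] by auto
  moreover have "inj_on f S"
    using homeomorphism_apply1[OF assms] by (metis inj_onI)
  ultimately show "inv_into S f y = g y"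
    using homeomorphism_apply1[OF assms] by simp
qed auto

lemma homeomorphism_conjugate:
  assumes "homeomorphism S S \<phi> \<psi>" "homeomorphism S S f g"
  shows "homeomorphism S S (\<phi> \<circ> f \<circ> \<psi>) (\<phi> \<circ> g \<circ> \<psi>)"
  using homeomorphism_compose[OF homeomorphism_compose[OF homeomorphism_symD[OF assms(1)] assms(2)] assms(1)]
  by (simp add: comp_assoc)

lemma lipschitz_on_increasing:
  fixes f :: "real \<Rightarrow> real"
  assumes "L \<ge> 0"
    and "\<And>x y. \<lbrakk>x \<in> K; y \<in> K; x \<le> y\<rbrakk> \<Longrightarrow> f x \<le> f y \<and> f y - f x \<le> L * (y - x)"
  shows "L-lipschitz_on K f"
proof (rule lipschitz_onI)
  fix x y assume "x \<in> K" "y \<in> K"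
  then show "dist (f x) (f y) \<le> L * dist x y"
    using assms(2)[of x y] assms(2)[of y x] by (cases "x \<le> y") (auto simp: dist_real_def)
qed (rule assms(1))

text \<open>Both the generators and their inverses are to become Lipschitz, so the weights are made
  quasi-invariant under a finite set \<open>T\<close> containing both.\<close>

lemma finitely_generated_bij_subgroup_weights:
  assumes \<Gamma>: "subgroup \<Gamma> (BijGroup X)" "subexponential_growth ((BijGroup X)\<lparr>carrier := \<Gamma>\<rparr>)"
    and \<G>: "finite \<G>" "generate (BijGroup X) \<G> = \<Gamma>"
    and "\<epsilon> > 0"
  obtains w :: "('a \<Rightarrow> 'a) \<Rightarrow> real" and T where
    "\<G> \<subseteq> T" "(\<lambda>g. restrict (inv_into X g) X) ` \<G> \<subseteq> T" "T \<subseteq> \<Gamma>"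
    "\<And>g. g \<in> \<Gamma> \<Longrightarrow> w g > 0" "(w has_sum 1) \<Gamma>"
    "\<And>g h. \<lbrakk>g \<in> \<Gamma>; h \<in> T\<rbrakk> \<Longrightarrow> w g \<le> exp \<epsilon> * w (compose X g h)"
proof -
  let ?T = "\<G> \<union> (\<lambda>g. restrict (inv_into X g) X) ` \<G>"
  have \<Gamma>_Bij: "\<Gamma> \<subseteq> Bij X"
    using subgroup.subset[OF \<Gamma>(1)] by (simp add: BijGroup_def)
  have \<G>_sub: "\<G> \<subseteq> \<Gamma>"
    using generate.incl[of _ \<G> "BijGroup X"] \<G>(2) by auto
  have T: "?T \<subseteq> \<Gamma>"
  proof -
    have "restrict (inv_into X g) X \<in> \<Gamma>" if "g \<in> \<G>" for g
      using generate.inv[OF that, of "BijGroup X"] \<G>(2) inv_BijGroup[of g X] that \<G>_sub \<Gamma>_Bij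
      by auto
    then show ?thesis
      using \<G>_sub by auto
  qed
  have mult: "g \<otimes>\<^bsub>(BijGroup X)\<lparr>carrier := \<Gamma>\<rparr>\<^esub> h = compose X g h" if "g \<in> \<Gamma>" "h \<in> \<Gamma>" for g h
    using that \<Gamma>_Bij by (auto simp: BijGroup_def)
  interpret group "(BijGroup X)\<lparr>carrier := \<Gamma>\<rparr>"
    using \<Gamma>(1) group_BijGroup by (rule subgroup.subgroup_is_group)
  obtain w where w: "\<And>g. g \<in> \<Gamma> \<Longrightarrow> w g > 0" "(w has_sum 1) \<Gamma>"
    and quasi_invariant: "\<And>g h. \<lbrakk>g \<in> \<Gamma>; h \<in> ?T\<rbrakk>
      \<Longrightarrow> w g \<le> exp \<epsilon> * w (g \<otimes>\<^bsub>(BijGroup X)\<lparr>carrier := \<Gamma>\<rparr>\<^esub> h)"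
    using subexponential_growth_weights[OF \<Gamma>(2), of ?T \<epsilon>] \<G>(1) T \<open>\<epsilon> > 0\<close> by auto
  show ?thesis
  proof (rule that[of ?T w])
    show "w g \<le> exp \<epsilon> * w (compose X g h)" if "g \<in> \<Gamma>" "h \<in> ?T" for g h
      using quasi_invariant[OF that] mult[OF that(1) subsetD[OF T that(2)]] by (simp only:)
  qed (use T w in auto)
qed

lemma circle_lipschitz_conjugacy:
  fixes \<Gamma> :: "(circle \<Rightarrow> circle) set"
  assumes \<Gamma>: "subgroup \<Gamma> (BijGroup UNIV)" "\<Gamma> \<subseteq> homeo_plus_circle"
      "subexponential_growth ((BijGroup UNIV)\<lparr>carrier := \<Gamma>\<rparr>)"
    and \<G>: "finite \<G>" "generate (BijGroup UNIV) \<G> = \<Gamma>"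
    and "\<epsilon> > 0"
  obtains \<phi> \<psi> :: "circle \<Rightarrow> circle" where "homeomorphism UNIV UNIV \<phi> \<psi>"
    "\<And>g. g \<in> \<G> \<Longrightarrow> homeomorphism UNIV UNIV (\<phi> \<circ> g \<circ> \<psi>) (\<phi> \<circ> inv_into UNIV g \<circ> \<psi>)"
    "\<And>g. g \<in> \<G> \<Longrightarrow> (exp \<epsilon>)-lipschitz_on UNIV (\<phi> \<circ> g \<circ> \<psi>)"
    "\<And>g. g \<in> \<G> \<Longrightarrow> (exp \<epsilon>)-lipschitz_on UNIV (\<phi> \<circ> inv_into UNIV g \<circ> \<psi>)"
proof -
  let ?G = "(BijGroup UNIV)\<lparr>carrier := \<Gamma>\<rparr>"
  obtain w T where T: "\<G> \<subseteq> T" "inv_into UNIV ` \<G> \<subseteq> T" "T \<subseteq> \<Gamma>"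
    and w: "\<And>g. g \<in> \<Gamma> \<Longrightarrow> w g > 0" "(w has_sum 1) \<Gamma>"
      "\<And>g h. \<lbrakk>g \<in> \<Gamma>; h \<in> T\<rbrakk> \<Longrightarrow> w g \<le> exp \<epsilon> * w (compose UNIV g h)"
    by (rule finitely_generated_bij_subgroup_weights[OF \<Gamma>(1,3) \<G> \<open>\<epsilon> > 0\<close>, unfolded restrict_UNIV])
      (rule that)
  have mult: "g \<otimes>\<^bsub>?G\<^esub> h = g \<circ> h" "compose UNIV g h = g \<circ> h" if "g \<in> \<Gamma>" "h \<in> \<Gamma>" for g h
    using that subgroup.subset[OF \<Gamma>(1)] by (auto simp: BijGroup_def compose_def)
  define L where "L g = (SOME F. lifts F g)" for g
  have L: "lifts (L g) g" if "g \<in> \<Gamma>" for g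
  proof -
    have "\<exists>F. lifts F g"
      using that \<Gamma>(2) unfolding homeo_plus_circle_def lifts_def by blast
    then show ?thesis
      unfolding L_def by (rule someI_ex)
  qed
  \<comment> \<open>a chosen lift is arbitrary up to an integer constant, possibly unbounded over the group;
    subtracting the value at \<open>0\<close> makes the sum converge\<close>
  define F where "F g x = L g x - L g 0" for g x
  interpret averaged_maps ?G w F UNIV
  proof (intro averaged_maps.intro averaged_maps_axioms.intro)
    show "group ?G"
      using \<Gamma>(1) group_BijGroup by (rule subgroup.subgroup_is_group)
    fix g assume "g \<in> carrier ?G"
    then have g: "lifts (L g) g"
      using L by simp
    show "strict_mono (F g)"
      using liftsD(2)[OF g] by (simp add: F_def strict_mono_def)
    show "continuous_on UNIV (F g)"
      unfolding F_def using liftsD(1)[OF g] by (intro continuous_intros)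
    show "\<bar>F g x\<bar> \<le> \<bar>x\<bar> + 1" for x
      unfolding F_def using g by (rule lifts_displacement_bound)
  qed (use w in auto)
  have shift: "average (x + 1) = average x + 1" for x
  proof -
    have "F g (x + 1) = F g x + 1" if "g \<in> \<Gamma>" for g
      using liftsD(3)[OF L[OF that]] by (simp add: F_def)
    then have "((\<lambda>g. w g * F g (x + 1)) has_sum (average x + 1)) \<Gamma>
        \<longleftrightarrow> ((\<lambda>g. w g * F g x + w g) has_sum (average x + 1)) \<Gamma>"
      by (intro has_sum_cong) (simp add: algebra_simps)
    then have "((\<lambda>g. w g * F g (x + 1)) has_sum (average x + 1)) \<Gamma>"
      using has_sum_add[OF average_has_sum[of x] weight_sum] by simp
    then show ?thesis
      using average_has_sum[of "x + 1"] by (simp add: has_sum_unique)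
  qed
  note avg = average_continuous average_strict_mono shift
  note inv_avg = degree_one_lift_homeomorphism[OF avg]
  define \<phi> where "\<phi> = descend average"
  define \<psi> where "\<psi> = descend (inv_into UNIV average)"
  have \<phi>: "lifts average \<phi>"
    unfolding \<phi>_def using avg by (rule lifts_descend)
  have \<psi>: "lifts (inv_into UNIV average) \<psi>"
    unfolding \<psi>_def using homeomorphism_cont2[OF inv_avg(1)] inv_avg(2,3) by (rule lifts_descend)
  have inverse: "inv_into UNIV average (average x) = x" "average (inv_into UNIV average x) = x" for x
    using homeomorphism_apply1[OF inv_avg(1)] homeomorphism_apply2[OF inv_avg(1)] by auto
  have homeo: "homeomorphism UNIV UNIV \<phi> \<psi>"
    using \<phi> \<psi> inverse by (rule lifts_homeomorphism)
  have lipschitz: "(exp \<epsilon>)-lipschitz_on UNIV (\<phi> \<circ> h \<circ> \<psi>)" if "h \<in> T" for h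
  proof (rule lifts_lipschitz)
    have h: "h \<in> \<Gamma>"
      using that T(3) by auto
    show "lifts (average \<circ> L h \<circ> inv_into UNIV average) (\<phi> \<circ> h \<circ> \<psi>)"
      using \<phi> \<psi> L[OF h] by (intro lifts_compose)
    fix x y :: real assume "x \<le> y"
    have "average (L h (inv_into UNIV average y)) - average (L h (inv_into UNIV average x))
        \<le> exp \<epsilon> * (average (inv_into UNIV average y) - average (inv_into UNIV average x))"
    proof (rule average_translate_le[where h = h])
      show "inv_into UNIV average x \<le> inv_into UNIV average y"
        using inv_avg(2) \<open>x \<le> y\<close> by (rule strict_mono_leD)
      show "w g \<le> exp \<epsilon> * w (g \<otimes>\<^bsub>?G\<^esub> h)" if "g \<in> carrier ?G" for g
        using w(3)[of g h] mult[of g h] that \<open>h \<in> T\<close> h by simp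
      fix g x y assume "g \<in> carrier ?G"
      then have g: "g \<in> \<Gamma>"
        by simp
      have "g \<circ> h \<in> \<Gamma>"
        using m_closed[of g h] mult[OF g h] g h by simp
      then have "L (g \<circ> h) y - L (g \<circ> h) x = (L g \<circ> L h) y - (L g \<circ> L h) x"
        by (rule lifts_increment_unique[OF L lifts_compose[OF L[OF g] L[OF h]]])
      then show "F g (L h y) - F g (L h x) = F (g \<otimes>\<^bsub>?G\<^esub> h) y - F (g \<otimes>\<^bsub>?G\<^esub> h) x"
        unfolding mult[OF g h] by (simp add: F_def)
    qed (use h in auto)
    then show "(average \<circ> L h \<circ> inv_into UNIV average) y
        - (average \<circ> L h \<circ> inv_into UNIV average) x \<le> exp \<epsilon> * (y - x)"
      by (simp add: inverse)
  qed simp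
  show ?thesis
  proof (rule that[OF homeo])
    fix g assume g: "g \<in> \<G>"
    show "(exp \<epsilon>)-lipschitz_on UNIV (\<phi> \<circ> g \<circ> \<psi>)" "(exp \<epsilon>)-lipschitz_on UNIV (\<phi> \<circ> inv_into UNIV g \<circ> \<psi>)"
      using lipschitz T g by auto
    have "g \<in> homeo_plus_circle"
      using g T \<Gamma>(2) by auto
    then obtain k where "homeomorphism UNIV UNIV g k"
      unfolding homeo_plus_circle_def by blast
    then show "homeomorphism UNIV UNIV (\<phi> \<circ> g \<circ> \<psi>) (\<phi> \<circ> inv_into UNIV g \<circ> \<psi>)"
      using homeo by (intro homeomorphism_conjugate homeomorphism_inv_into)
  qed
qed

lemma homeo_plus_interval_endpoints:
  assumes "f \<in> homeo_plus_interval"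
  shows "f 0 = 0" "f 1 = 1"
proof -
  obtain g where "homeomorphism {0..1} {0..1} f g"
    using assms by (auto simp: homeo_plus_interval_def)
  then have image: "f ` {0..1} = {0..1}"
    by (rule homeomorphism_image1)
  have mono: "f x \<le> f y" if "x \<in> {0..1}" "y \<in> {0..1}" "x \<le> y" for x y
    using assms that by (auto simp: homeo_plus_interval_def intro: strict_mono_on_leD)
  obtain a b where "a \<in> {0..1}" "f a = 0" "b \<in> {0..1}" "f b = 1"
    using image by (metis (no_types, lifting) atLeastAtMost_iff imageE order_refl zero_le_one)
  then have "f 0 \<le> 0" "1 \<le> f 1"
    using mono[of 0 a] mono[of b 1] by auto
  moreover have "f 0 \<in> {0..1}" "f 1 \<in> {0..1}"
    using image by auto
  ultimately show "f 0 = 0" "f 1 = 1"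
    by auto
qed

lemma interval_lipschitz_conjugacy:
  fixes \<Gamma> :: "(real \<Rightarrow> real) set"
  assumes \<Gamma>: "subgroup \<Gamma> (BijGroup {0..1})" "\<Gamma> \<subseteq> homeo_plus_interval"
      "subexponential_growth ((BijGroup {0..1})\<lparr>carrier := \<Gamma>\<rparr>)"
    and \<G>: "finite \<G>" "generate (BijGroup {0..1}) \<G> = \<Gamma>"
    and "\<epsilon> > 0"
  obtains \<phi> \<psi> :: "real \<Rightarrow> real" where "homeomorphism {0..1} {0..1} \<phi> \<psi>"
    "\<And>g. g \<in> \<G> \<Longrightarrow> homeomorphism {0..1} {0..1} (\<phi> \<circ> g \<circ> \<psi>) (\<phi> \<circ> inv_into {0..1} g \<circ> \<psi>)"
    "\<And>g. g \<in> \<G> \<Longrightarrow> (exp \<epsilon>)-lipschitz_on {0..1} (\<phi> \<circ> g \<circ> \<psi>)"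
    "\<And>g. g \<in> \<G> \<Longrightarrow> (exp \<epsilon>)-lipschitz_on {0..1} (\<phi> \<circ> inv_into {0..1} g \<circ> \<psi>)"
proof -
  let ?G = "(BijGroup {0..1::real})\<lparr>carrier := \<Gamma>\<rparr>"
  let ?I = "{0..1::real}"
  obtain w T where T: "\<G> \<subseteq> T" "(\<lambda>g. restrict (inv_into ?I g) ?I) ` \<G> \<subseteq> T" "T \<subseteq> \<Gamma>"
    and w: "\<And>g. g \<in> \<Gamma> \<Longrightarrow> w g > 0" "(w has_sum 1) \<Gamma>"
      "\<And>g h. \<lbrakk>g \<in> \<Gamma>; h \<in> T\<rbrakk> \<Longrightarrow> w g \<le> exp \<epsilon> * w (compose ?I g h)"
    by (rule finitely_generated_bij_subgroup_weights[OF \<Gamma>(1,3) \<G> \<open>\<epsilon> > 0\<close>]) (rule that)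
  have mult: "g \<otimes>\<^bsub>?G\<^esub> h = compose ?I g h" if "g \<in> \<Gamma>" "h \<in> \<Gamma>" for g h
    using that subgroup.subset[OF \<Gamma>(1)] by (auto simp: BijGroup_def)
  have strict: "strict_mono_on ?I g" and homeo: "homeomorphism ?I ?I g (inv_into ?I g)"
    if "g \<in> \<Gamma>" for g
    using that \<Gamma>(2) by (auto simp: homeo_plus_interval_def intro: homeomorphism_inv_into)
  have closed: "g x \<in> ?I" if "g \<in> \<Gamma>" "x \<in> ?I" for g x
    using homeomorphism_image1[OF homeo[OF that(1)]] that(2) by blast
  interpret averaged_maps ?G w "\<lambda>g. g" ?I
  proof (intro averaged_maps.intro averaged_maps_axioms.intro)
    show "group ?G"
      using \<Gamma>(1) group_BijGroup by (rule subgroup.subgroup_is_group)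
    fix g assume "g \<in> carrier ?G"
    then have g: "g \<in> \<Gamma>"
      by simp
    show "strict_mono_on ?I g"
      using g by (rule strict)
    show "continuous_on ?I g"
      using homeo[OF g] by (rule homeomorphism_cont1)
    show "\<bar>g x\<bar> \<le> \<bar>x\<bar> + 1" if "x \<in> ?I" for x
      using closed[OF g that] by auto
  qed (use w in auto)
  have value_0: "average 0 = 0"
  proof -
    have "((\<lambda>g. w g * g 0) has_sum 0) \<Gamma>"
      using \<Gamma>(2) homeo_plus_interval_endpoints(1) by (intro has_sum_0) auto
    then show ?thesis
      using average_has_sum[of 0] by (simp add: has_sum_unique)
  qed
  have value_1: "average 1 = 1"
  proof -
    have "((\<lambda>g. w g * g 1) has_sum 1) \<Gamma> \<longleftrightarrow> (w has_sum 1) \<Gamma>"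
      using \<Gamma>(2) homeo_plus_interval_endpoints(2) by (intro has_sum_cong) auto
    then show ?thesis
      using average_has_sum[of 1] w(2) by (simp add: has_sum_unique)
  qed
  have mono: "average x \<le> average y" if "x \<in> ?I" "y \<in> ?I" "x \<le> y" for x y
    using average_strict_mono that by (rule strict_mono_on_leD)
  have "average ` ?I = ?I"
  proof
    show "average ` ?I \<subseteq> ?I"
      using mono[of 0] mono[of _ 1] value_0 value_1 by auto
    show "?I \<subseteq> average ` ?I"
    proof
      fix y assume "y \<in> ?I"
      then have "\<exists>x\<ge>0. x \<le> 1 \<and> average x = y"
        using value_0 value_1 average_continuous by (intro IVT') auto
      then show "y \<in> average ` ?I"
        by auto
    qed
  qed
  moreover have "inj_on average ?I"
    using average_strict_mono by (rule strict_mono_on_imp_inj_on)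
  ultimately obtain \<psi> where \<psi>: "homeomorphism ?I ?I average \<psi>"
    using homeomorphism_compact[OF _ average_continuous] by blast
  have \<psi>_in: "\<psi> x \<in> ?I" if "x \<in> ?I" for x
    using homeomorphism_image2[OF \<psi>] that by blast
  have lipschitz: "(exp \<epsilon>)-lipschitz_on ?I (average \<circ> h \<circ> \<psi>)" if "h \<in> T" for h
  proof (rule lipschitz_on_increasing)
    have h: "h \<in> \<Gamma>"
      using that T(3) by auto
    fix x y assume xy: "x \<in> ?I" "y \<in> ?I" "x \<le> y"
    have inverse: "average (\<psi> x) = x" "average (\<psi> y) = y"
      using homeomorphism_apply2[OF \<psi>] xy by auto
    have le: "\<psi> x \<le> \<psi> y"
      using strict_mono_onD[OF average_strict_mono \<psi>_in[OF xy(2)] \<psi>_in[OF xy(1)]] inverse xy(3)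
      by linarith
    have "average (h (\<psi> y)) - average (h (\<psi> x)) \<le> exp \<epsilon> * (average (\<psi> y) - average (\<psi> x))"
    proof (rule average_translate_le[where h = h])
      show "h ` ?I \<subseteq> ?I"
        using closed[OF h] by auto
      show "w g \<le> exp \<epsilon> * w (g \<otimes>\<^bsub>?G\<^esub> h)" if "g \<in> carrier ?G" for g
        using w(3)[of g h] mult[of g h] that \<open>h \<in> T\<close> h by simp
      show "g (h v) - g (h u) = (g \<otimes>\<^bsub>?G\<^esub> h) v - (g \<otimes>\<^bsub>?G\<^esub> h) u"
        if "g \<in> carrier ?G" "u \<in> ?I" "v \<in> ?I" for g u v
        using mult[of g h] that h by (simp add: compose_eq)
    qed (use h \<psi>_in xy le in auto)
    moreover have "average (h (\<psi> x)) \<le> average (h (\<psi> y))"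
      using closed[OF h] strict_mono_on_leD[OF strict[OF h]] \<psi>_in xy le by (intro mono) auto
    ultimately show "(average \<circ> h \<circ> \<psi>) x \<le> (average \<circ> h \<circ> \<psi>) y \<and>
        (average \<circ> h \<circ> \<psi>) y - (average \<circ> h \<circ> \<psi>) x \<le> exp \<epsilon> * (y - x)"
      by (simp add: inverse)
  qed simp
  show ?thesis
  proof (rule that[OF \<psi>])
    fix g assume g: "g \<in> \<G>"
    show "(exp \<epsilon>)-lipschitz_on ?I (average \<circ> g \<circ> \<psi>)"
      using lipschitz T g by auto
    have "(exp \<epsilon>)-lipschitz_on ?I (average \<circ> restrict (inv_into ?I g) ?I \<circ> \<psi>)"
      using lipschitz[OF subsetD[OF T(2) imageI[OF g]]] .
    then show "(exp \<epsilon>)-lipschitz_on ?I (average \<circ> inv_into ?I g \<circ> \<psi>)"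
      using \<psi>_in by (simp add: lipschitz_on_def)
    show "homeomorphism ?I ?I (average \<circ> g \<circ> \<psi>) (average \<circ> inv_into ?I g \<circ> \<psi>)"
      using homeo[of g] T g \<psi> by (intro homeomorphism_conjugate) auto
  qed
qed

theorem mainTheorem1:
  fixes \<epsilon> :: real
  assumes "\<epsilon> > 0"
  shows
    "(\<forall>(\<Gamma> :: (circle \<Rightarrow> circle) set) \<G>.
        subgroup \<Gamma> (BijGroup UNIV) \<and> \<Gamma> \<subseteq> homeo_plus_circle \<and>
        subexponential_growth ((BijGroup UNIV)\<lparr>carrier := \<Gamma>\<rparr>) \<and>
        finite \<G> \<and> generate (BijGroup UNIV) \<G> = \<Gamma> \<longrightarrow>
        (\<exists>(\<phi> :: circle \<Rightarrow> circle) \<psi>. homeomorphism UNIV UNIV \<phi> \<psi> \<and>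
           (\<forall>g\<in>\<G>.
              homeomorphism UNIV UNIV (\<phi> \<circ> g \<circ> \<psi>) (\<phi> \<circ> inv_into UNIV g \<circ> \<psi>) \<and>
              (exp \<epsilon>)-lipschitz_on UNIV (\<phi> \<circ> g \<circ> \<psi>) \<and>
              (exp \<epsilon>)-lipschitz_on UNIV (\<phi> \<circ> inv_into UNIV g \<circ> \<psi>)))) \<and>
     (\<forall>(\<Gamma> :: (real \<Rightarrow> real) set) \<G>.
        subgroup \<Gamma> (BijGroup {0..1}) \<and> \<Gamma> \<subseteq> homeo_plus_interval \<and>
        subexponential_growth ((BijGroup {0..1})\<lparr>carrier := \<Gamma>\<rparr>) \<and>
        finite \<G> \<and> generate (BijGroup {0..1}) \<G> = \<Gamma> \<longrightarrow>
        (\<exists>(\<phi> :: real \<Rightarrow> real) \<psi>. homeomorphism {0..1} {0..1} \<phi> \<psi> \<and>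
           (\<forall>g\<in>\<G>.
              homeomorphism {0..1} {0..1} (\<phi> \<circ> g \<circ> \<psi>) (\<phi> \<circ> inv_into {0..1} g \<circ> \<psi>) \<and>
              (exp \<epsilon>)-lipschitz_on {0..1} (\<phi> \<circ> g \<circ> \<psi>) \<and>
              (exp \<epsilon>)-lipschitz_on {0..1} (\<phi> \<circ> inv_into {0..1} g \<circ> \<psi>))))"
proof (intro conjI allI impI; elim conjE)
  fix \<Gamma> \<G> :: "(circle \<Rightarrow> circle) set"
  assume "subgroup \<Gamma> (BijGroup UNIV)" "\<Gamma> \<subseteq> homeo_plus_circle"
    "subexponential_growth ((BijGroup UNIV)\<lparr>carrier := \<Gamma>\<rparr>)"
    "finite \<G>" "generate (BijGroup UNIV) \<G> = \<Gamma>"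
  note hyps = this
  show "\<exists>(\<phi> :: circle \<Rightarrow> circle) \<psi>. homeomorphism UNIV UNIV \<phi> \<psi> \<and>
      (\<forall>g\<in>\<G>. homeomorphism UNIV UNIV (\<phi> \<circ> g \<circ> \<psi>) (\<phi> \<circ> inv_into UNIV g \<circ> \<psi>) \<and>
        (exp \<epsilon>)-lipschitz_on UNIV (\<phi> \<circ> g \<circ> \<psi>) \<and>
        (exp \<epsilon>)-lipschitz_on UNIV (\<phi> \<circ> inv_into UNIV g \<circ> \<psi>))"
    by (rule circle_lipschitz_conjugacy[OF hyps assms]) blast
next
  fix \<Gamma> \<G> :: "(real \<Rightarrow> real) set"
  assume "subgroup \<Gamma> (BijGroup {0..1})" "\<Gamma> \<subseteq> homeo_plus_interval"
    "subexponential_growth ((BijGroup {0..1})\<lparr>carrier := \<Gamma>\<rparr>)"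
    "finite \<G>" "generate (BijGroup {0..1}) \<G> = \<Gamma>"
  note hyps = this
  show "\<exists>(\<phi> :: real \<Rightarrow> real) \<psi>. homeomorphism {0..1} {0..1} \<phi> \<psi> \<and>
      (\<forall>g\<in>\<G>. homeomorphism {0..1} {0..1} (\<phi> \<circ> g \<circ> \<psi>) (\<phi> \<circ> inv_into {0..1} g \<circ> \<psi>) \<and>
        (exp \<epsilon>)-lipschitz_on {0..1} (\<phi> \<circ> g \<circ> \<psi>) \<and>
        (exp \<epsilon>)-lipschitz_on {0..1} (\<phi> \<circ> inv_into {0..1} g \<circ> \<psi>))"
    by (rule interval_lipschitz_conjugacy[OF hyps assms]) blast
qed

end
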